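(* Let $R$ be a commutative ring with identity, $M$ a finitely generated faithful multiplication $R$-module and $N$ a submodule of $M$ satisfying $(0:_M S)\subseteq N$ for every subset $S\subseteq R$ with $S\nsubseteq J(R)$. If $N$ is a maximal weakly $J$-submodule of $M$, then $N$ is a $J$-submodule of $M$.
   Context: Rings are commutative with identity and modules are unital. $J(R)$ is the Jacobson radical of $R$. For a submodule $N$ of an $R$-module $M$, $(N:M)=\{r\in R: rM\subseteq N\}$, and for a subset $S\subseteq R$, $(N:_M S)=\{m\in M: Sm\subseteq N\}$. An $R$-module $M$ is a multiplication module if every submodule of $M$ has the form $IM$ for some ideal $I$ of $R$. A proper submodule $N$ of $M$ is a $J$-submodule if whenever $r\in R$, $m\in M$ satisfy $rm\in N$ and $r\notin (J(R)M:M)$, then $m\in N$. A proper submodule $N$ of $M$ is a weakly $J$-submodule if whenever $r\in R$, $m\in M$ satisfy $0\neq rm\in N$ and $r\notin (J(R)M:M)$, then $m\in N$. A maximal weakly $J$-submodule of $M$ is a weakly $J$-submodule $N$ of $M$ such that no weakly $J$-submodule of $M$ properly contains $N$. *)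

theory Defs
  imports "HOL-Algebra.Ideal" "HOL-Algebra.Module"
begin

text \<open>For the zero ring, which has no maximal ideals, this is the whole carrier.\<close>

definition jacobson_radical :: "('a, 'r) ring_scheme \<Rightarrow> 'a set"
  where "jacobson_radical R = carrier R \<inter> \<Inter>{I. maximalideal I R}"

definition gensubmodule ::
    "('a, 'r) ring_scheme \<Rightarrow> ('a, 'b, 'm) module_scheme \<Rightarrow> 'b set \<Rightarrow> 'b set"
  where "gensubmodule R M X = \<Inter>{N. submodule N R M \<and> X \<subseteq> N}"

lemma (in module) gensubmodule_submodule:
  assumes "X \<subseteq> carrier M"
  shows "submodule (gensubmodule R M X) R M"
proof -
  let ?F = "{N. submodule N R M \<and> X \<subseteq> N}"
  have sub: "\<And>N. N \<in> ?F \<Longrightarrow> submodule N R M" and M: "carrier M \<in> ?F"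
    using carrier_is_submodule assms by auto
  have "submodule (\<Inter>?F) R M"
  proof (rule submoduleI)
    show "\<Inter>?F \<subseteq> carrier M"
      using M by (rule Inter_lower)
    show "\<zero>\<^bsub>M\<^esub> \<in> \<Inter>?F"
      using subgroup.one_closed[OF submodule.axioms(1)[OF sub]] by simp
    show "\<ominus>\<^bsub>M\<^esub> a \<in> \<Inter>?F" if "a \<in> \<Inter>?F" for a
      by (rule InterI) (rule submoduleE(3)[OF sub], assumption, rule InterD[OF that])
    show "a \<oplus>\<^bsub>M\<^esub> b \<in> \<Inter>?F" if "a \<in> \<Inter>?F" "b \<in> \<Inter>?F" for a b
      by (rule InterI) (rule submoduleE(5)[OF sub], assumption,
          rule InterD[OF that(1)], assumption, rule InterD[OF that(2)])
    show "a \<odot>\<^bsub>M\<^esub> x \<in> \<Inter>?F" if "a \<in> carrier R" "x \<in> \<Inter>?F" for a x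
      by (rule InterI) (rule submoduleE(4)[OF sub that(1)], assumption, rule InterD[OF that(2)])
  qed
  then show ?thesis
    unfolding gensubmodule_def .
qed

text \<open>The product \<open>I M\<close>: the submodule generated by all \<open>a m\<close> with \<open>a \<in> I\<close> and \<open>m \<in> M\<close>.\<close>

definition ideal_smult ::
    "('a, 'r) ring_scheme \<Rightarrow> 'a set \<Rightarrow> ('a, 'b, 'm) module_scheme \<Rightarrow> 'b set"
  where "ideal_smult R I M =
    gensubmodule R M {a \<odot>\<^bsub>M\<^esub> m | a m. a \<in> I \<and> m \<in> carrier M}"

text \<open>The ideal \<open>(N : M)\<close> of \<open>R\<close>.\<close>

definition residual ::
    "('a, 'r) ring_scheme \<Rightarrow> 'b set \<Rightarrow> ('a, 'b, 'm) module_scheme \<Rightarrow> 'a set"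
  where "residual R N M = {r \<in> carrier R. \<forall>m \<in> carrier M. r \<odot>\<^bsub>M\<^esub> m \<in> N}"

text \<open>The subset \<open>(N :\<^sub>M S)\<close> of \<open>M\<close>.\<close>

definition residual_in ::
    "('a, 'b, 'm) module_scheme \<Rightarrow> 'b set \<Rightarrow> 'a set \<Rightarrow> 'b set"
  where "residual_in M N S = {m \<in> carrier M. \<forall>s \<in> S. s \<odot>\<^bsub>M\<^esub> m \<in> N}"

definition finitely_generated_module ::
    "('a, 'r) ring_scheme \<Rightarrow> ('a, 'b, 'm) module_scheme \<Rightarrow> bool"
  where "finitely_generated_module R M \<longleftrightarrow>
    (\<exists>X. finite X \<and> X \<subseteq> carrier M \<and> gensubmodule R M X = carrier M)"

definition faithful_module ::
    "('a, 'r) ring_scheme \<Rightarrow> ('a, 'b, 'm) module_scheme \<Rightarrow> bool"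
  where "faithful_module R M \<longleftrightarrow> residual R {\<zero>\<^bsub>M\<^esub>} M = {\<zero>\<^bsub>R\<^esub>}"

definition multiplication_module ::
    "('a, 'r) ring_scheme \<Rightarrow> ('a, 'b, 'm) module_scheme \<Rightarrow> bool"
  where "multiplication_module R M \<longleftrightarrow>
    (\<forall>N. submodule N R M \<longrightarrow> (\<exists>I. ideal I R \<and> N = ideal_smult R I M))"

definition J_submodule ::
    "'b set \<Rightarrow> ('a, 'r) ring_scheme \<Rightarrow> ('a, 'b, 'm) module_scheme \<Rightarrow> bool"
  where "J_submodule N R M \<longleftrightarrow>
    submodule N R M \<and> N \<noteq> carrier M \<and>
    (\<forall>r \<in> carrier R. \<forall>m \<in> carrier M.
      r \<odot>\<^bsub>M\<^esub> m \<in> N \<and> r \<notin> residual R (ideal_smult R (jacobson_radical R) M) M \<longrightarrow> m \<in> N)"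

definition weakly_J_submodule ::
    "'b set \<Rightarrow> ('a, 'r) ring_scheme \<Rightarrow> ('a, 'b, 'm) module_scheme \<Rightarrow> bool"
  where "weakly_J_submodule N R M \<longleftrightarrow>
    submodule N R M \<and> N \<noteq> carrier M \<and>
    (\<forall>r \<in> carrier R. \<forall>m \<in> carrier M.
      \<zero>\<^bsub>M\<^esub> \<noteq> r \<odot>\<^bsub>M\<^esub> m \<and> r \<odot>\<^bsub>M\<^esub> m \<in> N \<and>
      r \<notin> residual R (ideal_smult R (jacobson_radical R) M) M \<longrightarrow> m \<in> N)"

definition maximal_weakly_J_submodule ::
    "'b set \<Rightarrow> ('a, 'r) ring_scheme \<Rightarrow> ('a, 'b, 'm) module_scheme \<Rightarrow> bool"
  where "maximal_weakly_J_submodule N R M \<longleftrightarrow>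
    weakly_J_submodule N R M \<and> \<not> (\<exists>K. weakly_J_submodule K R M \<and> N \<subset> K)"

end

theory Submission
  imports Defs
begin

lemma ideal_subset_residual_ideal_smult:
  assumes "I \<subseteq> carrier R"
  shows "I \<subseteq> residual R (ideal_smult R I M) M"
  using assms unfolding residual_def ideal_smult_def gensubmodule_def by blast

text \<open>An implication \<open>r m \<in> N \<Longrightarrow> m \<in> N\<close> with \<open>r \<notin> (J(R) M : M)\<close> can fail for a
  weakly \<open>J\<close>-submodule \<open>N\<close> only when \<open>r m = 0\<close>. Since \<open>J(R) \<subseteq> (J(R) M : M)\<close>, such an \<open>r\<close> lies
  outside \<open>J(R)\<close>, so the annihilator hypothesis for the singleton \<open>S = {r}\<close> puts \<open>m\<close> into \<open>N\<close>.\<close>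

theorem theorem2:
  fixes R :: "('a, 'r) ring_scheme"
    and M :: "('a, 'b, 'm) module_scheme"
    and N :: "'b set"
  assumes "cring R"
    and "module R M"
    and "finitely_generated_module R M"
    and "faithful_module R M"
    and "multiplication_module R M"
    and "submodule N R M"
    and "\<And>S. S \<subseteq> carrier R \<Longrightarrow> \<not> S \<subseteq> jacobson_radical R \<Longrightarrow>
               residual_in M {\<zero>\<^bsub>M\<^esub>} S \<subseteq> N"
    and "maximal_weakly_J_submodule N R M"
  shows "J_submodule N R M"
proof -
  have weak: "weakly_J_submodule N R M"
    using assms(8) unfolding maximal_weakly_J_submodule_def by blast
  have "m \<in> N"
    if r: "r \<in> carrier R" and m: "m \<in> carrier M" and rm: "r \<odot>\<^bsub>M\<^esub> m \<in> N"
      and nres: "r \<notin> residual R (ideal_smult R (jacobson_radical R) M) M" for r m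
  proof (cases "r \<odot>\<^bsub>M\<^esub> m = \<zero>\<^bsub>M\<^esub>")
    case True
    have "jacobson_radical R \<subseteq> carrier R"
      unfolding jacobson_radical_def by blast
    then have "r \<notin> jacobson_radical R"
      using nres ideal_subset_residual_ideal_smult by blast
    then have "residual_in M {\<zero>\<^bsub>M\<^esub>} {r} \<subseteq> N"
      using assms(7)[of "{r}"] r by blast
    then show ?thesis
      using True m unfolding residual_in_def by blast
  next
    case False
    then show ?thesis
      using weak r m rm nres unfolding weakly_J_submodule_def by metis
  qed
  then show ?thesis
    using weak unfolding J_submodule_def weakly_J_submodule_def by blast
qed

end
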